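(* Let $n\ge 1$ and let $\mathcal{X}:=(x_1,x_2,\ldots,x_n)$ be a self-conjugate list of complex numbers with nonnegative real parts (so every $e_j(\mathcal{X})$ is real). Let $k\leq l$ be integers. Then the following inequalities hold: (i) if $1\leq k\leq l\leq \lfloor n/2\rfloor-1$, then $$e_{2k}(\mathcal{X})e_{2l}(\mathcal{X})\geq \frac{(l+1)(\lfloor n/2 \rfloor-k+1)}{k(\lfloor n/2 \rfloor-l)}\,e_{2k-2}(\mathcal{X})e_{2l+2}(\mathcal{X});$$ (ii) if $1\leq k\leq l\leq \lceil n/2\rceil-2$, then $$e_{2k+1}(\mathcal{X})e_{2l+1}(\mathcal{X})\geq \frac{(l+1)(\lceil n/2 \rceil-k)}{k(\lceil n/2 \rceil-l-1)}\,e_{2k-1}(\mathcal{X})e_{2l+3}(\mathcal{X});$$ (iii) for all $k\le l$, $$e_{2k-1}(\mathcal{X})e_{2l}(\mathcal{X})\geq e_{2k-2}(\mathcal{X})e_{2l+1}(\mathcal{X});$$ (iv) for all $k\le l$, $$e_{2k}(\mathcal{X})e_{2l+1}(\mathcal{X})\geq e_{2k-1}(\mathcal{X})e_{2l+2}(\mathcal{X}).$$ Furthermore, if all real numbers in $\mathcal{X}$ appear with even multiplicity (so that $n$ is even), then (v) if $1\leq k\leq l\leq n/2-1$, $$e_{2k}(\mathcal{X})e_{2l}(\mathcal{X})\geq \sqrt{\frac{l(n-2k)}{k(n-2l)}}\;e_{2k-1}(\mathcal{X})e_{2l+1}(\mathcal{X}).$$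
   Context: For a list $\mathcal{X}=(x_1,\ldots,x_n)$ of complex numbers, $e_j(\mathcal{X})$ denotes the $j$-th elementary symmetric function: $e_0(\mathcal{X}):=1$, $e_j(\mathcal{X}):=\sum_{1\leq i_1<i_2<\cdots<i_j\leq n}x_{i_1}x_{i_2}\cdots x_{i_j}$ for $1\le j\le n$, and $e_j(\mathcal{X}):=0$ if $j<0$ or $j>n$. A list of complex numbers is self-conjugate if its nonreal entries occur in complex-conjugate pairs, i.e. each nonreal number and its complex conjugate appear in the list with the same multiplicity. *)

theory Defs
  imports Complex_Main "HOL-Combinatorics.Permutations"
begin

(* An increasing index tuple i_1 < ... < i_j is encoded as the j-element set of its (0-based)
   indices. *)
definition esym :: "int \<Rightarrow> complex list \<Rightarrow> complex" where
  "esym j xs =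
     (if j < 0 \<or> int (length xs) < j then 0
      else (\<Sum>I | I \<subseteq> {..<length xs} \<and> card I = nat j. \<Prod>i\<in>I. xs ! i))"

definition self_conjugate :: "complex list \<Rightarrow> bool" where
  "self_conjugate xs \<longleftrightarrow> (\<forall>z. z \<notin> \<real> \<longrightarrow> count_list xs z = count_list xs (cnj z))"

lemma esym_0: "esym 0 xs = 1"
proof -
  have "I \<subseteq> {..<length xs} \<and> card I = 0 \<longleftrightarrow> I = {}" for I :: "nat set"
    using finite_subset[OF _ finite_lessThan, of I "length xs"] by (cases "I = {}") auto
  then show ?thesis by (simp add: esym_def)
qed

lemma esym_permute:
  assumes "mset xs = mset ys"
  shows "esym j xs = esym j ys"
proof -
  obtain p where p: "p permutes {..<length ys}" and xs: "permute_list p ys = xs"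
    using mset_eq_permutation[OF assms] by metis
  have len: "length xs = length ys" using assms by (rule mset_eq_length)
  have inj: "inj p" using p by (rule permutes_inj)
  have ip: "inv p permutes {..<length ys}" using p by (rule permutes_inv)
  let ?S = "{I. I \<subseteq> {..<length ys} \<and> card I = nat j}"
  have "(\<Sum>I\<in>?S. \<Prod>i\<in>I. xs ! i) = (\<Sum>I\<in>?S. \<Prod>i\<in>I. ys ! i)"
  proof (rule sum.reindex_bij_witness[where i = "\<lambda>I. inv p ` I" and j = "\<lambda>I. p ` I"])
    fix I assume I: "I \<in> ?S"
    show "inv p ` p ` I = I" using inj by (simp add: image_image)
    show "p ` inv p ` I = I" using p by (simp add: image_image permutes_inverses)
    have "p ` I \<subseteq> {..<length ys}"
      using I permutes_image[OF p] image_mono[of I "{..<length ys}" p] by simp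
    moreover have "card (p ` I) = card I"
      by (rule card_image[OF inj_on_subset[OF inj subset_UNIV]])
    ultimately show "p ` I \<in> ?S" using I by auto
    have "inv p ` I \<subseteq> {..<length ys}"
      using I permutes_image[OF ip] image_mono[of I "{..<length ys}" "inv p"] by simp
    moreover have "card (inv p ` I) = card I"
      by (rule card_image[OF inj_on_subset[OF permutes_inj[OF ip] subset_UNIV]])
    ultimately show "inv p ` I \<in> ?S" using I by auto
    have "(\<Prod>i\<in>p ` I. ys ! i) = (\<Prod>i\<in>I. ys ! p i)"
      by (simp add: prod.reindex[OF inj_on_subset[OF inj subset_UNIV]])
    also have "\<dots> = (\<Prod>i\<in>I. xs ! i)"
      using I by (intro prod.cong) (auto simp: xs[symmetric] permute_list_nth[OF p])
    finally show "(\<Prod>i\<in>p ` I. ys ! i) = (\<Prod>i\<in>I. xs ! i)" .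
  qed
  then show ?thesis by (simp add: esym_def len)
qed

lemma cnj_esym: "cnj (esym j xs) = esym j (map cnj xs)"
proof -
  have "cnj (\<Prod>i\<in>I. xs ! i) = (\<Prod>i\<in>I. map cnj xs ! i)" if "I \<subseteq> {..<length xs}" for I
    unfolding cnj_prod using that by (intro prod.cong) (simp_all add: subset_eq)
  then have "(\<Sum>I | I \<subseteq> {..<length xs} \<and> card I = nat j. cnj (\<Prod>i\<in>I. xs ! i)) =
      (\<Sum>I | I \<subseteq> {..<length xs} \<and> card I = nat j. \<Prod>i\<in>I. map cnj xs ! i)"
    by (intro sum.cong[OF refl]) blast
  then show ?thesis by (simp only: esym_def cnj_sum length_map if_distrib[of cnj] complex_cnj_zero)
qed

lemma mset_map_cnj:
  assumes "self_conjugate xs"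
  shows "mset (map cnj xs) = mset xs"
proof (rule multiset_eqI)
  fix z
  have "count_list (map cnj xs) z = count_list xs (cnj z)"
  proof (induction xs)
    case (Cons a xs)
    have "cnj a = z \<longleftrightarrow> a = cnj z" by (metis complex_cnj_cnj)
    with Cons show ?case by simp
  qed simp
  also have "\<dots> = count_list xs z"
    using assms unfolding self_conjugate_def by (metis Reals_cnj_iff)
  finally show "count (mset (map cnj xs)) z = count (mset xs) z"
    by (simp only: count_mset)
qed

lemma esym_Reals:
  assumes "self_conjugate xs"
  shows "esym j xs \<in> \<real>"
  using esym_permute[OF mset_map_cnj[OF assms], of j]
  unfolding Reals_cnj_iff cnj_esym .

(* For a self-conjugate list, esym_Reals shows that taking the real part loses nothing. *)
definition re_esym :: "int \<Rightarrow> complex list \<Rightarrow> real" where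
  "re_esym j xs = Re (esym j xs)"

lemma of_real_re_esym: "self_conjugate xs \<Longrightarrow> of_real (re_esym j xs) = esym j xs"
  by (simp add: re_esym_def esym_Reals)

end

theory Submission
  imports Defs "HOL-Computational_Algebra.Fundamental_Theorem_Algebra"
    "HOL-Library.Quadratic_Discriminant"
begin

text \<open>Replacing each \<open>x\<close> by \<open>x + \<epsilon>\<close>, we may assume that all real parts are positive. Then
  \<open>\<Prod>(1 + x t)\<close> is a product of real factors \<open>1 + a t + b t\<^sup>2\<close> with \<open>a > 0\<close> and \<open>b \<ge> 0\<close>, and we write it
  as \<open>E (t\<^sup>2) + t O (t\<^sup>2)\<close>. Its modulus at \<open>t\<close> exceeds that at \<open>- t\<close> when \<open>Re t > 0\<close>, so \<open>E\<close> and \<open>O\<close>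
  are real-rooted, and Newton's inequalities for them are (i) and (ii). The inequalities (iii) and
  (iv) for \<open>k = l\<close> say that certain minors of the coefficients of \<open>E g\<close> and \<open>O g\<close> are nonnegative
  for \<open>g = 1\<close>; for all real-rooted \<open>g\<close> this follows by induction on the number of factors. Under the
  hypothesis of (v) all factors satisfy \<open>a\<^sup>2 \<le> 4 b\<close>, and a second induction, again over all
  real-rooted \<open>g\<close>, gives (v) for \<open>k = l\<close>. Since all \<open>e\<^sub>j\<close> are positive, the general case of (iii) and
  (iv) follows by comparing consecutive ratios, and that of (v) from its diagonal case and (ii).\<close>

subsection \<open>Real-rooted polynomials and Newton's inequalities\<close>

abbreviation cpoly :: "real poly \<Rightarrow> complex poly" where
  "cpoly \<equiv> map_poly complex_of_real"

lemma cpoly_pCons [simp]: "cpoly (pCons a p) = pCons (complex_of_real a) (cpoly p)"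
  by (simp add: map_poly_pCons)

lemma cpoly_add [simp]: "cpoly (p + q) = cpoly p + cpoly q"
  by (rule poly_eqI) (simp add: coeff_map_poly)

lemma cpoly_smult [simp]: "cpoly (smult c p) = smult (complex_of_real c) (cpoly p)"
  by (rule poly_eqI) (simp add: coeff_map_poly)

lemma cpoly_mult [simp]: "cpoly (p * q) = cpoly p * cpoly q"
  by (rule poly_eqI) (simp add: coeff_map_poly coeff_mult)

lemma cpoly_pderiv: "cpoly (pderiv p) = pderiv (cpoly p)"
  by (rule poly_eqI) (simp add: coeff_map_poly coeff_pderiv)

lemma cpoly_eq_0_iff [simp]: "cpoly p = 0 \<longleftrightarrow> p = 0"
  by (rule map_poly_eq_0_iff) auto

lemma degree_cpoly [simp]: "degree (cpoly p) = degree p"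
  by (rule degree_map_poly) simp

lemma cpoly_reflect: "cpoly (reflect_poly p) = reflect_poly (cpoly p)"
  by (rule poly_eqI) (simp add: coeff_map_poly coeff_reflect_poly)

definition real_rooted :: "real poly \<Rightarrow> bool" where
  "real_rooted p \<longleftrightarrow> p \<noteq> 0 \<and> (\<forall>z. poly (cpoly p) z = 0 \<longrightarrow> z \<in> \<real>)"

lemma real_rooted_nonzero: "real_rooted p \<Longrightarrow> p \<noteq> 0"
  by (simp add: real_rooted_def)

lemma real_rooted_1: "real_rooted 1"
  by (simp add: real_rooted_def)

lemma real_rooted_mult: "real_rooted p \<Longrightarrow> real_rooted q \<Longrightarrow> real_rooted (p * q)"
  by (auto simp: real_rooted_def)

lemma real_rooted_linear: "real_rooted [:1, b:]"
proof -
  have "z \<in> \<real>" if "1 + z * complex_of_real b = 0" for z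
  proof -
    have "b \<noteq> 0" using that by auto
    moreover have "z * of_real b = -1" using that by (simp add: add_eq_0_iff)
    ultimately have "z = of_real (-1 / b)" by (simp add: field_simps)
    then show ?thesis by (metis Reals_of_real)
  qed
  then show ?thesis by (simp add: real_rooted_def)
qed

lemma real_rooted_pCons_0_iff: "real_rooted (pCons 0 p) \<longleftrightarrow> real_rooted p"
  by (auto simp: real_rooted_def)

text \<open>The imaginary part of \<open>p' / p = (\<Sum>r. 1 / (z - r))\<close> has a strict sign off the real line.\<close>

lemma log_deriv_Im:
  assumes "\<forall>r\<in>#A. r \<in> \<real>" and "Im z \<noteq> 0" and "A \<noteq> {#}"
  defines "P \<equiv> (\<Prod>r\<in>#A. [:- r, 1:])"
  shows "poly P z \<noteq> 0 \<and> Im z * Im (poly (pderiv P) z / poly P z) < 0"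
  using assms(1,3) unfolding P_def
proof (induction A)
  case (add r A)
  have r: "r = of_real (Re r)" using add.prems by (simp add: complex_is_Real_iff complex_eq_iff)
  then have zr: "z - r \<noteq> 0" using assms(2) by (metis Im_complex_of_real eq_iff_diff_eq_0)
  obtain x where x: "r = of_real x" using r by blast
  have "Im (1 / (z - r)) = - Im z / (cmod (z - r))\<^sup>2"
    unfolding x by (simp add: Im_divide cmod_power2)
  then have neg: "Im z * Im (1 / (z - r)) < 0"
    using zr assms(2) by (simp add: divide_less_0_iff not_less power2_eq_square[symmetric])
  let ?Q = "\<Prod>r\<in>#A. [:- r, 1:]"
  show ?case
  proof (cases "A = {#}")
    case True
    then show ?thesis using zr neg by (simp add: pderiv_pCons)
  next
    case False
    then have IH: "poly ?Q z \<noteq> 0" "Im z * Im (poly (pderiv ?Q) z / poly ?Q z) < 0"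
      using add by auto
    have "poly (pderiv (\<Prod>r\<in>#add_mset r A. [:- r, 1:])) z / poly (\<Prod>r\<in>#add_mset r A. [:- r, 1:]) z
        = poly (pderiv ?Q) z / poly ?Q z + 1 / (z - r)"
    proof -
      have "poly (pderiv ([:- r, 1:] * ?Q)) z = (z - r) * poly (pderiv ?Q) z + poly ?Q z"
        unfolding pderiv_mult by (simp add: pderiv_pCons algebra_simps)
      moreover have "poly ([:- r, 1:] * ?Q) z = (z - r) * poly ?Q z"
        by (simp add: algebra_simps)
      ultimately show ?thesis using zr IH(1) by (simp add: add_divide_distrib)
    qed
    then show ?thesis using zr IH neg by (simp add: distrib_left)
  qed
qed simp

text \<open>Factor \<open>p\<close> over the complex numbers: all its roots are real, so
  \<open>log_deriv_Im\<close> keeps the derivative from vanishing at a nonreal point.\<close>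

lemma real_rooted_pderiv:
  assumes "real_rooted p" and "degree p > 0"
  shows "real_rooted (pderiv p)"
proof -
  obtain A where A: "size A = degree p" "cpoly p = smult (lead_coeff (cpoly p)) (\<Prod>x\<in>#A. [:-x, 1:])"
    using alg_closed_imp_factorization[of "cpoly p"] real_rooted_nonzero[OF assms(1)] by auto
  let ?P = "\<Prod>x\<in>#A. [:-x, 1:]"
  let ?c = "lead_coeff (cpoly p)"
  have c: "?c \<noteq> 0" using real_rooted_nonzero[OF assms(1)] by (metis cpoly_eq_0_iff leading_coeff_0_iff)
  have "A \<noteq> {#}" using A(1) assms(2) by auto
  have roots: "\<forall>r\<in>#A. r \<in> \<real>"
  proof
    fix r assume "r \<in># A"
    then have "poly ?P r = 0"
      by (metis (no_types, lifting) dvdI dvd_prod_mset image_eqI in_image_mset poly_eq_0_iff_dvd)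
    then show "r \<in> \<real>" using assms(1) A(2) unfolding real_rooted_def by (metis mult_zero_right poly_smult)
  qed
  have "z \<in> \<real>" if "poly (cpoly (pderiv p)) z = 0" for z
  proof (rule ccontr)
    assume "z \<notin> \<real>"
    then have "Im z \<noteq> 0" by (simp add: complex_is_Real_iff)
    from log_deriv_Im[OF roots this \<open>A \<noteq> {#}\<close>]
    have "poly (pderiv ?P) z \<noteq> 0" by auto
    moreover have "cpoly (pderiv p) = smult ?c (pderiv ?P)"
      by (metis A(2) cpoly_pderiv pderiv_smult)
    ultimately show False using that c by simp
  qed
  moreover have "pderiv p \<noteq> 0" using assms(2) by (simp add: pderiv_eq_0_iff)
  ultimately show ?thesis by (simp add: real_rooted_def)
qed

text \<open>The nonzero roots of the reflected polynomial are the inverses of roots of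
  \<open>p\<close>.\<close>

lemma real_rooted_reflect_poly:
  assumes "real_rooted p"
  shows "real_rooted (reflect_poly p)"
proof -
  have "z \<in> \<real>" if "poly (cpoly (reflect_poly p)) z = 0" for z
  proof (cases "z = 0")
    case False
    then have "poly (cpoly p) (inverse z) = 0"
      using that by (simp add: cpoly_reflect poly_reflect_poly_nz)
    then have "inverse z \<in> \<real>" using assms unfolding real_rooted_def by blast
    then show ?thesis by (metis Reals_inverse inverse_inverse_eq)
  qed simp
  then show ?thesis using assms by (simp add: real_rooted_def)
qed

lemma real_rooted_quadratic_discriminant:
  assumes "real_rooted p" and "degree p = 2"
  shows "4 * coeff p 0 * coeff p 2 \<le> (coeff p 1)\<^sup>2"
proof (rule ccontr)
  define a b c where "a = coeff p 2" and "b = coeff p 1" and "c = coeff p 0"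
  assume "\<not> ?thesis"
  then have neg: "4 * a * c - b\<^sup>2 > 0" by (simp add: a_def b_def c_def mult_ac)
  have a: "a \<noteq> 0" using assms(2) unfolding a_def by (metis degree_0 leading_coeff_0_iff zero_neq_numeral)
  have p: "p = [:c, b, a:]"
    by (rule poly_eqI) (use assms(2) in \<open>auto simp: coeff_pCons a_def b_def c_def numeral_2_eq_2
      coeff_eq_0 split: nat.splits\<close>)
  \<comment> \<open>The quadratic formula; the imaginary part is nonzero because the discriminant is
    negative.\<close>
  define z where "z = Complex (- b / (2 * a)) (sqrt (4 * a * c - b\<^sup>2) / (2 * a))"
  have "poly (cpoly p) z = 0"
  proof -
    have "Re (poly (cpoly p) z) = 0" "Im (poly (cpoly p) z) = 0"
      using a neg by (simp_all add: p z_def field_simps power2_eq_square)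
    then show ?thesis by (simp add: complex_eq_iff)
  qed
  moreover have "z \<notin> \<real>" using a neg by (simp add: complex_is_Real_iff z_def)
  ultimately show False using assms(1) by (simp add: real_rooted_def)
qed

section \<open>Newton's inequalities by differentiation and reflection\<close>

text \<open>For degree \<open>i + j + 2\<close> this is Newton's inequality at the index
  \<open>i + 1\<close> with the binomial coefficients cleared; \<open>j\<close> counts the
  coefficients above index \<open>i + 2\<close>.\<close>

definition newton_at :: "nat \<Rightarrow> nat \<Rightarrow> real poly \<Rightarrow> bool" where
  "newton_at i j p \<longleftrightarrow>
     real ((i + 2) * (j + 2)) * (coeff p i * coeff p (i + 2)) \<le> real ((i + 1) * (j + 1)) * (coeff p (i + 1))\<^sup>2"

text \<open>The factors that differentiation brings in leave a common factor
  \<open>(i + 1) * (i + 2)\<close>, which cancels.\<close>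

lemma newton_at_pderiv:
  assumes "newton_at i j (pderiv p)"
  shows "newton_at (Suc i) j p"
proof -
  let ?k = "real (i + 1) * real (i + 2)"
  have "?k * (real ((i + 3) * (j + 2)) * (coeff p (i + 1) * coeff p (i + 3)))
      \<le> ?k * (real ((i + 2) * (j + 1)) * (coeff p (i + 2))\<^sup>2)"
    using assms by (simp add: newton_at_def coeff_pderiv numeral_eq_Suc algebra_simps)
  then have "real ((i + 3) * (j + 2)) * (coeff p (i + 1) * coeff p (i + 3))
      \<le> real ((i + 2) * (j + 1)) * (coeff p (i + 2))\<^sup>2"
    by (subst (asm) mult_le_cancel_left_pos) auto
  then show ?thesis by (simp add: newton_at_def numeral_eq_Suc)
qed

text \<open>Differentiating \<open>i\<close> times leaves a quadratic, for which the inequality is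
  the discriminant condition.\<close>

lemma newton_at_top:
  "real_rooted p \<Longrightarrow> degree p = i + 2 \<Longrightarrow> newton_at i 0 p"
proof (induction i arbitrary: p)
  case 0
  then show ?case using real_rooted_quadratic_discriminant[of p] by (simp add: newton_at_def numeral_2_eq_2)
next
  case (Suc i)
  then show ?case by (intro newton_at_pderiv Suc.IH real_rooted_pderiv) (auto simp: degree_pderiv)
qed

text \<open>Reflection exchanges the two ends of the coefficient sequence. It preserves the degree
  if the constant coefficient is nonzero; otherwise the left side is 0.\<close>

lemma newton_at_bottom:
  assumes "real_rooted p" and "degree p = j + 2"
  shows "newton_at 0 j p"
proof (cases "coeff p 0 = 0")
  case False
  have "newton_at j 0 (reflect_poly p)"
    using False assms by (intro newton_at_top real_rooted_reflect_poly) auto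
  then show ?thesis using assms(2) by (simp add: newton_at_def coeff_reflect_poly algebra_simps numeral_eq_Suc)
qed (simp add: newton_at_def)

text \<open>Differentiating \<open>i\<close> times moves the index to 0, where
  \<open>newton_at_bottom\<close> applies.\<close>

lemma newton_inequality:
  "real_rooted p \<Longrightarrow> degree p = i + j + 2 \<Longrightarrow> newton_at i j p"
proof (induction i arbitrary: p)
  case 0
  then show ?case by (simp add: newton_at_bottom)
next
  case (Suc i)
  then show ?case by (intro newton_at_pderiv Suc.IH real_rooted_pderiv) (auto simp: degree_pderiv)
qed

text \<open>A form of Newton's inequality free of the degree. If the left side is positive, the
  degree is at least \<open>i + 2\<close>, so a suitable \<open>j\<close> exists.\<close>

lemma real_rooted_log_concave:
  assumes "real_rooted p"
  shows "coeff p i * coeff p (i + 2) \<le> (coeff p (i + 1))\<^sup>2"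
proof (cases "coeff p i * coeff p (i + 2) \<le> 0")
  case True
  then show ?thesis by (meson order_trans zero_le_power2)
next
  case False
  then have "degree p \<ge> i + 2" by (metis le_degree mult_zero_right order_refl)
  then obtain j where "degree p = i + j + 2" by (metis le_add_diff_inverse add.commute add.left_commute)
  from newton_inequality[OF assms this]
  have N: "real ((i + 2) * (j + 2)) * (coeff p i * coeff p (i + 2)) \<le> real ((i + 1) * (j + 1)) * (coeff p (i + 1))\<^sup>2"
    by (simp add: newton_at_def)
  have "real ((i + 1) * (j + 1)) * (coeff p i * coeff p (i + 2)) \<le>
      real ((i + 2) * (j + 2)) * (coeff p i * coeff p (i + 2))"
    using False by (intro mult_right_mono) (auto simp: of_nat_mono mult_mono)
  with N have "real ((i + 1) * (j + 1)) * (coeff p i * coeff p (i + 2)) \<le> real ((i + 1) * (j + 1)) * (coeff p (i + 1))\<^sup>2"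
    by linarith
  then show ?thesis by (subst (asm) mult_le_cancel_left_pos) (auto simp del: of_nat_mult)
qed

subsection \<open>Even and odd parts of stable polynomials\<close>

text \<open>Writing \<open>(\<Prod>(a, b)\<leftarrow>fs. 1 + a t + b t\<^sup>2) = E (t\<^sup>2) + t O (t\<^sup>2)\<close>, the polynomial \<open>even_part fs\<close>
  is \<open>E (s)\<close>, but \<open>odd_part fs\<close> is \<open>s O (s)\<close>, which makes the recursion symmetric; its
  coefficient of index \<open>k\<close> is \<open>e\<close> of index \<open>2k - 1\<close>.\<close>

fun even_part odd_part :: "(real \<times> real) list \<Rightarrow> real poly" where
  "even_part [] = 1"
| "odd_part [] = 0"
| "even_part ((a, b) # fs) = [:1, b:] * even_part fs + smult a (odd_part fs)"
| "odd_part ((a, b) # fs) = [:1, b:] * odd_part fs + smult a (pCons 0 (even_part fs))"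

lemma norm_quadratic_reflection:
  assumes "a > 0" and "b \<ge> 0" and "Re t > 0"
  shows "cmod (1 - of_real a * t + of_real b * t\<^sup>2) < cmod (1 + of_real a * t + of_real b * t\<^sup>2)"
proof (rule power2_less_imp_less)
  have "(cmod (1 + of_real a * t + of_real b * t\<^sup>2))\<^sup>2 - (cmod (1 - of_real a * t + of_real b * t\<^sup>2))\<^sup>2
      = 4 * a * Re t * (1 + b * (cmod t)\<^sup>2)"
    unfolding cmod_power2 by (simp add: algebra_simps power2_eq_square)
  moreover have "\<dots> > 0" using assms by (intro mult_pos_pos add_pos_nonneg) auto
  ultimately show "(cmod (1 - of_real a * t + of_real b * t\<^sup>2))\<^sup>2 < (cmod (1 + of_real a * t + of_real b * t\<^sup>2))\<^sup>2"
    by linarith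
qed simp

text \<open>Since \<open>odd_part\<close> carries an extra factor \<open>s\<close>, the sum and the
  difference are \<open>t\<close> times the product of all factors at \<open>t\<close> and at
  \<open>- t\<close>. The comparisons of the single factors multiply, and one factor suffices for
  strictness.\<close>

lemma hermite_biehler_norm:
  assumes "\<forall>(a, b)\<in>set fs. a > 0 \<and> b \<ge> 0" and "Re t > 0"
  defines "e \<equiv> \<lambda>fs. poly (cpoly (even_part fs)) (t\<^sup>2)" and "f \<equiv> \<lambda>fs. poly (cpoly (odd_part fs)) (t\<^sup>2)"
  shows "0 < cmod (t * e fs + f fs) \<and> cmod (t * e fs - f fs) \<le> cmod (t * e fs + f fs) \<and>
    (fs \<noteq> [] \<longrightarrow> cmod (t * e fs - f fs) < cmod (t * e fs + f fs))"
  using assms(1)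
proof (induction fs)
  case Nil
  then show ?case using assms(2) by (auto simp: e_def f_def)
next
  case (Cons ab fs)
  obtain a b where ab: "ab = (a, b)" by force
  with Cons.prems have "a > 0" "b \<ge> 0" by auto
  note q = norm_quadratic_reflection[OF this assms(2)]
  have IH: "0 < cmod (t * e fs + f fs)" "cmod (t * e fs - f fs) \<le> cmod (t * e fs + f fs)"
    using Cons by auto
  have plus: "t * e (ab # fs) + f (ab # fs) = (1 + of_real a * t + of_real b * t\<^sup>2) * (t * e fs + f fs)"
    by (simp add: ab e_def f_def algebra_simps power2_eq_square)
  have minus: "t * e (ab # fs) - f (ab # fs) = (1 - of_real a * t + of_real b * t\<^sup>2) * (t * e fs - f fs)"
    by (simp add: ab e_def f_def algebra_simps power2_eq_square)
  have "cmod (1 - of_real a * t + of_real b * t\<^sup>2) * cmod (t * e fs - f fs)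
      < cmod (1 + of_real a * t + of_real b * t\<^sup>2) * cmod (t * e fs + f fs)"
    using mult_left_mono[OF IH(2) norm_ge_zero] mult_strict_right_mono[OF q IH(1)]
    by (rule order_le_less_trans)
  moreover have "0 < cmod (1 + of_real a * t + of_real b * t\<^sup>2)"
    using q by (meson norm_ge_zero order_le_less_trans)
  ultimately show ?case
    unfolding plus minus norm_mult using IH(1) by auto
qed

text \<open>Every nonreal number is the square of one with positive real part, namely of its
  principal root.\<close>

lemma real_rooted_if_no_zero_square:
  assumes "p \<noteq> 0" and "\<And>t. Re t > 0 \<Longrightarrow> poly (cpoly p) (t\<^sup>2) \<noteq> 0"
  shows "real_rooted p"
proof -
  have "z \<in> \<real>" if z: "poly (cpoly p) z = 0" for z
  proof (rule ccontr)
    assume "z \<notin> \<real>"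
    then have "Im z \<noteq> 0" by (simp add: complex_is_Real_iff)
    have sq: "(csqrt z)\<^sup>2 = z" by simp
    have "Im ((csqrt z)\<^sup>2) = 2 * Re (csqrt z) * Im (csqrt z)" by (simp add: power2_eq_square)
    then have "Re (csqrt z) \<noteq> 0" using \<open>Im z \<noteq> 0\<close> unfolding sq by auto
    moreover have "Re (csqrt z) \<ge> 0"
      using csqrt_principal[of z] by auto
    ultimately show False using assms(2)[of "csqrt z"] z by simp
  qed
  then show ?thesis using assms(1) by (simp add: real_rooted_def)
qed

text \<open>A zero at \<open>t^2\<close> would make the two moduli in
  \<open>hermite_biehler_norm\<close> equal, against strictness. The same argument serves
  \<open>odd_part\<close>.\<close>

lemma real_rooted_even_part:
  assumes "\<forall>(a, b)\<in>set fs. a > 0 \<and> b \<ge> 0"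
  shows "real_rooted (even_part fs)"
proof (cases "fs = []")
  case False
  have "poly (cpoly (even_part fs)) (t\<^sup>2) \<noteq> 0" if "Re t > 0" for t
    using hermite_biehler_norm[OF assms that] False by auto
  moreover from this[of 1] have "even_part fs \<noteq> 0" by auto
  ultimately show ?thesis by (intro real_rooted_if_no_zero_square) auto
qed (simp add: real_rooted_1)

lemma real_rooted_odd_part:
  assumes "\<forall>(a, b)\<in>set fs. a > 0 \<and> b \<ge> 0" and "fs \<noteq> []"
  shows "real_rooted (odd_part fs)"
proof -
  have "poly (cpoly (odd_part fs)) (t\<^sup>2) \<noteq> 0" if "Re t > 0" for t
    using hermite_biehler_norm[OF assms(1) that] assms(2) by auto
  moreover from this[of 1] have "odd_part fs \<noteq> 0" by auto
  ultimately show ?thesis by (intro real_rooted_if_no_zero_square) auto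
qed

section \<open>Minors formed from the even and odd parts\<close>

lemma coeff_linear_mult: "coeff ([:1, b:] * p) (Suc i) = coeff p (Suc i) + b * coeff p i"
  for b :: real
  by simp

lemma coeff_even_part_Cons_mult:
  "coeff (even_part ((a, b) # fs) * h) (Suc i) =
    coeff (even_part fs * h) (Suc i) + b * coeff (even_part fs * h) i + a * coeff (odd_part fs * h) (Suc i)"
proof -
  have "even_part ((a, b) # fs) * h = [:1, b:] * (even_part fs * h) + smult a (odd_part fs * h)"
    unfolding even_part.simps by (simp only: distrib_right mult.assoc mult_smult_left)
  then show ?thesis by simp
qed

lemma coeff_odd_part_Cons_mult:
  "coeff (odd_part ((a, b) # fs) * h) (Suc i) =
    coeff (odd_part fs * h) (Suc i) + b * coeff (odd_part fs * h) i + a * coeff (even_part fs * h) i"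
proof -
  have "odd_part ((a, b) # fs) * h = [:1, b:] * (odd_part fs * h) + smult a (pCons 0 (even_part fs * h))"
    unfolding odd_part.simps by (simp only: distrib_right mult.assoc mult_smult_left mult_pCons_left smult_0_left add_0_left)
  then show ?thesis by simp
qed

lemma coeff_mult_linear: "coeff (p * ([:1, b:] * h)) (Suc i) = coeff (p * h) (Suc i) + b * coeff (p * h) i"
  for b :: real
  by (metis coeff_linear_mult mult.left_commute)

text \<open>Adding a factor changes the minors by log-concavity defects of \<open>E g\<close> and \<open>O g\<close> and by minors
  for \<open>g\<close> and \<open>(1 + b s) g\<close>.\<close>

lemma interlacing_minors:
  assumes "\<forall>(a, b)\<in>set fs. a > 0 \<and> b \<ge> 0" and "real_rooted g"
  defines "e \<equiv> \<lambda>fs g. coeff (even_part fs * g)" and "f \<equiv> \<lambda>fs g. coeff (odd_part fs * g)"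
  shows "e fs g k * f fs g (k + 2) \<le> e fs g (k + 1) * f fs g (k + 1) \<and>
    f fs g k * e fs g (k + 1) \<le> f fs g (k + 1) * e fs g k"
  using assms(1,2)
proof (induction fs arbitrary: g k)
  case Nil
  then show ?case by (simp add: f_def)
next
  case (Cons ab fs)
  obtain a b where ab: "ab = (a, b)" by force
  with Cons.prems have a: "a > 0" and b: "b \<ge> 0" and fs: "\<forall>(a, b)\<in>set fs. a > 0 \<and> b \<ge> 0" by auto
  \<comment> \<open>Multiplying by \<open>s^2\<close> makes room below index \<open>k\<close>: the
    coefficients of index \<open>k - 1\<close> become \<open>E 1\<close> and \<open>F 1\<close>,
    which are 0 when \<open>k = 0\<close>.\<close>
  define h where "h = pCons 0 (pCons 0 g)"
  have h: "real_rooted h" using Cons.prems(2) by (simp add: h_def real_rooted_pCons_0_iff)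
  have shift: "e fs' g i = e fs' h (i + 2)" "f fs' g i = f fs' h (i + 2)" for fs' i
    by (simp_all add: h_def e_def f_def)
  define E where "E i = e fs h (k + i)" for i
  define F where "F i = f fs h (k + i)" for i
  have e': "e (ab # fs) h (k + Suc i) = E (Suc i) + b * E i + a * F (Suc i)" for i
    by (simp add: E_def F_def e_def f_def ab coeff_even_part_Cons_mult del: even_part.simps)
  have f': "f (ab # fs) h (k + Suc i) = F (Suc i) + b * F i + a * E i" for i
    by (simp add: E_def F_def e_def f_def ab coeff_odd_part_Cons_mult del: odd_part.simps)
  have Lh: "real_rooted ([:1, b:] * h)" by (intro real_rooted_mult real_rooted_linear h)
  have eL: "e fs ([:1, b:] * h) (k + Suc i) = E (Suc i) + b * E i" for i
    unfolding e_def E_def add_Suc_right coeff_mult_linear by simp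
  have fL: "f fs ([:1, b:] * h) (k + Suc i) = F (Suc i) + b * F i" for i
    unfolding f_def F_def add_Suc_right coeff_mult_linear by simp
  have mE: "E 1 * E 3 \<le> (E 2)\<^sup>2"
    using real_rooted_log_concave[OF real_rooted_mult[OF real_rooted_even_part[OF fs] h], of "k + 1"]
    by (simp add: E_def e_def numeral_eq_Suc)
  have mF: "F i * F (i + 2) \<le> (F (i + 1))\<^sup>2" for i
  \<comment> \<open>\<open>odd_part []\<close> is 0, hence not \<open>real_rooted\<close>, so the
    empty list is treated apart.\<close>
  proof (cases "fs = []")
    case False
    then show ?thesis
      using real_rooted_log_concave[OF real_rooted_mult[OF real_rooted_odd_part[OF fs] h], of "k + i"]
      by (simp add: F_def f_def numeral_eq_Suc)
  qed (simp add: F_def f_def)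
  have m1: "E 1 * F 3 \<le> E 2 * F 2" and m2: "F 2 * E 3 \<le> F 3 * E 2"
    using Cons.IH[OF fs h, of "k + 1"] Cons.IH[OF fs h, of "k + 2"]
    by (simp_all add: E_def F_def numeral_eq_Suc)
  have m3: "(E 2 + b * E 1) * (F 4 + b * F 3) \<le> (E 3 + b * E 2) * (F 3 + b * F 2)"
    and m4: "(F 2 + b * F 1) * (E 3 + b * E 2) \<le> (F 3 + b * F 2) * (E 2 + b * E 1)"
    using Cons.IH[OF fs Lh, of "k + 2"] eL[of 1] eL[of 2] fL[of 1] fL[of 2] fL[of 3]
    by (simp_all add: numeral_eq_Suc)
  have "(E 2 + b * E 1 + a * F 2) * (F 4 + b * F 3 + a * E 3) \<le>
      (E 3 + b * E 2 + a * F 3) * (F 3 + b * F 2 + a * E 2)"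
  proof -
    \<comment> \<open>In powers of \<open>a\<close>, the constant term is the same minor for
      \<open>(1 + b s) h\<close>, the linear term consists of log-concavity defects, and the
      quadratic term is a minor of the other kind for \<open>h\<close>. This is why both kinds are
      proved together.\<close>
    have "(E 3 + b * E 2 + a * F 3) * (F 3 + b * F 2 + a * E 2)
      - (E 2 + b * E 1 + a * F 2) * (F 4 + b * F 3 + a * E 3) =
      ((E 3 + b * E 2) * (F 3 + b * F 2) - (E 2 + b * E 1) * (F 4 + b * F 3))
      + a * (((F 3)\<^sup>2 - F 2 * F 4) + b * ((E 2)\<^sup>2 - E 1 * E 3)) + a\<^sup>2 * (F 3 * E 2 - F 2 * E 3)"
      by (simp add: power2_eq_square algebra_simps)
    moreover have "\<dots> \<ge> 0"
      using a b mE mF[of 2] m2 m3 by (intro add_nonneg_nonneg mult_nonneg_nonneg) auto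
    ultimately show ?thesis by linarith
  qed
  moreover have "(F 2 + b * F 1 + a * E 1) * (E 3 + b * E 2 + a * F 3) \<le>
      (F 3 + b * F 2 + a * E 2) * (E 2 + b * E 1 + a * F 2)"
  proof -
    have "(F 3 + b * F 2 + a * E 2) * (E 2 + b * E 1 + a * F 2)
      - (F 2 + b * F 1 + a * E 1) * (E 3 + b * E 2 + a * F 3) =
      ((F 3 + b * F 2) * (E 2 + b * E 1) - (F 2 + b * F 1) * (E 3 + b * E 2))
      + a * (b * ((F 2)\<^sup>2 - F 1 * F 3) + ((E 2)\<^sup>2 - E 1 * E 3)) + a\<^sup>2 * (E 2 * F 2 - E 1 * F 3)"
      by (simp add: power2_eq_square algebra_simps)
    moreover have "\<dots> \<ge> 0"
      using a b mE mF[of 1] m1 m4 by (intro add_nonneg_nonneg mult_nonneg_nonneg) (auto simp: numeral_eq_Suc)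
    ultimately show ?thesis by linarith
  qed
  ultimately show ?case
    using e'[of 1] e'[of 2] f'[of 1] f'[of 2] f'[of 3]
    by (simp add: shift numeral_eq_Suc)
qed

section \<open>The diagonal inequality for factors with \<open>a^2 \<le> 4 b\<close>\<close>

lemma quadratic_nonneg_discriminant:
  fixes p q r :: real
  assumes "\<And>z. 0 \<le> p * z\<^sup>2 + q * z + r"
  shows "q\<^sup>2 \<le> 4 * p * r"
proof (rule ccontr)
  assume "\<not> ?thesis"
  then have d: "discrim p q r > 0" by (simp add: discrim_def)
  show False
  proof (cases "p = 0")
    case True
    then have "q \<noteq> 0" using d by (auto simp: discrim_def)
    then show False using assms[of "- (r + 1) / q"] True by simp
  next
    case False
    \<comment> \<open>Completing the square: \<open>z s\<close> satisfies
      \<open>2 * p * z s + q = s\<close>. The vertex \<open>s = 0\<close> excludes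
      \<open>p > 0\<close>, and \<open>s = 1 + discrim p q r\<close> lies far enough out to exclude
      \<open>p < 0\<close>.\<close>
    define z where "z s = (s - q) / (2 * p)" for s
    have sq: "4 * p * (p * (z s)\<^sup>2 + q * z s + r) = s\<^sup>2 - discrim p q r" for s
    proof -
      have "s\<^sup>2 = (2 * p * z s + q)\<^sup>2" using False by (simp add: z_def)
      then show ?thesis by (simp add: discrim_def power2_eq_square algebra_simps)
    qed
    have "4 * p * (p * (z 0)\<^sup>2 + q * z 0 + r) < 0" using d unfolding sq by simp
    then have "p < 0" using assms[of "z 0"] by (simp add: mult_less_0_iff)
    then have "4 * p * (p * (z (1 + discrim p q r))\<^sup>2 + q * z (1 + discrim p q r) + r) \<le> 0"
      using mult_nonpos_nonneg[of "4 * p", OF _ assms] by simp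
    then have "(1 + discrim p q r)\<^sup>2 \<le> discrim p q r" unfolding sq by simp
    moreover have "discrim p q r < (1 + discrim p q r)\<^sup>2"
      using d by (simp add: power2_eq_square algebra_simps add_pos_pos)
    ultimately show False by simp
  qed
qed

text \<open>Viewed as a function of \<open>a\<close>, the difference of the two sides is either nondecreasing or
  concave, so it suffices to look at \<open>a = 0\<close> and \<open>a = 2 * sqrt b\<close>; at the latter point it exceeds
  its value for \<open>(a, b)\<close> replaced by \<open>(0, - b)\<close>.\<close>

lemma quadratic_factor_step:
  fixes u v w x y a b :: real
  assumes pencil: "\<And>z. (v + z * x) * (y + z * v) \<le> (u + z * w)\<^sup>2"
    and \<alpha>: "w * y \<le> u * v" and \<beta>: "x * u \<le> v * w"
    and a: "0 \<le> a" and ab: "a\<^sup>2 \<le> 4 * b"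
  shows "(v + b * x + a * w) * (y + b * v + a * u) \<le> (u + b * w + a * v)\<^sup>2"
proof -
  \<comment> \<open>\<open>\<alpha>\<close> and \<open>\<beta>\<close> are the slacks of the two
    minor inequalities; the discriminant of the pencil \<open>q\<close> will bound \<open>B\<close>
    in terms of them.\<close>
  define \<alpha> \<beta> B where "\<alpha> = u * v - w * y" and "\<beta> = v * w - x * u" and "B = v\<^sup>2 - x * y"
  have nn: "\<alpha> \<ge> 0" "\<beta> \<ge> 0" using assms by (simp_all add: \<alpha>_def \<beta>_def)
  have b: "b \<ge> 0" using ab by (smt (verit) zero_le_power2)
  define q where "q z = (u + z * w)\<^sup>2 - (v + z * x) * (y + z * v)" for z
  have q: "q z \<ge> 0" for z using pencil[of z] by (simp add: q_def)
  have qz: "q z = (w\<^sup>2 - x * v) * z\<^sup>2 + (2 * u * w - v\<^sup>2 - x * y) * z + (u\<^sup>2 - v * y)" for z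
    by (simp add: q_def power2_eq_square algebra_simps)
  have "(2 * u * w - v\<^sup>2 - x * y)\<^sup>2 \<le> 4 * (w\<^sup>2 - x * v) * (u\<^sup>2 - v * y)"
    using q unfolding qz by (rule quadratic_nonneg_discriminant)
  moreover have "(2 * u * w - v\<^sup>2 - x * y)\<^sup>2 - 4 * (w\<^sup>2 - x * v) * (u\<^sup>2 - v * y) = B\<^sup>2 - 4 * (\<alpha> * \<beta>)"
    by (simp add: \<alpha>_def \<beta>_def B_def power2_eq_square algebra_simps)
  ultimately have disc: "B\<^sup>2 \<le> 4 * (\<alpha> * \<beta>)" by linarith
  define c where "c = sqrt b"
  have c: "c \<ge> 0" "c\<^sup>2 = b" using b by (simp_all add: c_def)
  \<comment> \<open>By the arithmetic-geometric mean inequality,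
    \<open>B^2 \<le> 4 \<alpha> \<beta>\<close> bounds the modulus of \<open>c B\<close> by
    \<open>\<alpha> + c^2 \<beta>\<close>.\<close>
  have abc: "\<alpha> + c * B + b * \<beta> \<ge> 0"
  proof (rule ccontr)
    assume "\<not> ?thesis"
    then have "\<alpha> + b * \<beta> < \<bar>c * B\<bar>" by linarith
    moreover have "0 \<le> \<alpha> + b * \<beta>" using nn b by simp
    ultimately have "(\<alpha> + b * \<beta>)\<^sup>2 < \<bar>c * B\<bar>\<^sup>2" by (rule power_strict_mono) simp
    also have "\<dots> = (c * B)\<^sup>2" by simp
    also have "\<dots> \<le> b * (4 * (\<alpha> * \<beta>))" using disc b by (simp add: power_mult_distrib c mult_left_mono)
    finally have "(\<alpha> - b * \<beta>)\<^sup>2 < 0" by (simp add: power2_eq_square algebra_simps)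
    then show False by (meson not_less zero_le_power2)
  qed
  have Q: "(u + b * w + t * v)\<^sup>2 - (v + b * x + t * w) * (y + b * v + t * u)
      = q b + t * (\<alpha> + b * \<beta>) + t\<^sup>2 * (v\<^sup>2 - u * w)" for t
    by (simp add: q_def \<alpha>_def \<beta>_def power2_eq_square algebra_simps)
  have "0 \<le> q b + a * (\<alpha> + b * \<beta>) + a\<^sup>2 * (v\<^sup>2 - u * w)"
  proof (cases "v\<^sup>2 \<ge> u * w")
    case True
    then show ?thesis using nn a b q by (intro add_nonneg_nonneg mult_nonneg_nonneg) auto
  next
    case False
    have a2c: "a \<le> 2 * c"
      by (rule power2_le_imp_le) (use ab c in \<open>simp_all add: power_mult_distrib\<close>)
    have top: "0 \<le> q b + 2 * c * (\<alpha> + b * \<beta>) + (2 * c)\<^sup>2 * (v\<^sup>2 - u * w)"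
    proof -
      have "q b + 2 * c * (\<alpha> + b * \<beta>) + (2 * c)\<^sup>2 * (v\<^sup>2 - u * w) = q (- b) + 2 * c * (\<alpha> + c * B + b * \<beta>)"
        unfolding qz by (simp add: B_def c(2)[symmetric] power2_eq_square algebra_simps)
      then show ?thesis using q[of "-b"] abc c(1) by simp
    qed
    show ?thesis
    proof (cases "c = 0")
      case True
      then show ?thesis using a2c a q by simp
    next
      case c0: False
      \<comment> \<open>\<open>\<tau>\<close> locates \<open>a\<close> between 0 and
        \<open>2 * c\<close>. The identity below is the chord between the two endpoint values plus a
        term that concavity makes nonnegative.\<close>
      define \<tau> where "\<tau> = a / (2 * c)"
      have \<tau>: "a = 2 * c * \<tau>" "0 \<le> \<tau>" "\<tau> \<le> 1" using c0 c(1) a a2c by (auto simp: \<tau>_def)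
      have "q b + a * (\<alpha> + b * \<beta>) + a\<^sup>2 * (v\<^sup>2 - u * w)
        = (1 - \<tau>) * q b + \<tau> * (q b + 2 * c * (\<alpha> + b * \<beta>) + (2 * c)\<^sup>2 * (v\<^sup>2 - u * w))
          + (2 * c)\<^sup>2 * (\<tau> * (1 - \<tau>)) * (u * w - v\<^sup>2)"
        unfolding \<tau>(1) by (simp add: power2_eq_square algebra_simps)
      moreover have "0 \<le> (1 - \<tau>) * q b" using q \<tau>(3) by simp
      moreover have "0 \<le> \<tau> * (q b + 2 * c * (\<alpha> + b * \<beta>) + (2 * c)\<^sup>2 * (v\<^sup>2 - u * w))"
        using \<tau>(2) top by (rule mult_nonneg_nonneg)
      moreover have "0 \<le> (2 * c)\<^sup>2 * (\<tau> * (1 - \<tau>)) * (u * w - v\<^sup>2)"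
        using \<tau>(2,3) False by simp
      ultimately show ?thesis by linarith
    qed
  qed
  then show ?thesis unfolding Q[symmetric] by simp
qed

text \<open>The auxiliary real-rooted factor \<open>g\<close>, with roots of arbitrary sign, is what makes the
  induction work: the step applies the hypothesis to \<open>(1 + z s) g\<close> for all real \<open>z\<close>.\<close>

lemma odd_part_le_even_part:
  assumes "\<forall>(a, b)\<in>set fs. a > 0 \<and> a\<^sup>2 \<le> 4 * b" and "real_rooted g"
  shows "coeff (odd_part fs * g) k * coeff (odd_part fs * g) (k + 1) \<le> (coeff (even_part fs * g) k)\<^sup>2"
  using assms
proof (induction fs arbitrary: g k)
  case (Cons ab fs)
  obtain a b where ab: "ab = (a, b)" by force
  with Cons.prems have a: "a > 0" "a\<^sup>2 \<le> 4 * b" and fs: "\<forall>(a, b)\<in>set fs. a > 0 \<and> a\<^sup>2 \<le> 4 * b" by auto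
  then have fs': "\<forall>(a, b)\<in>set fs. a > 0 \<and> b \<ge> 0" by (smt (verit) case_prodE case_prodI2 zero_le_power2 case_prodD)
  \<comment> \<open>Shifting by one power of \<open>s\<close> lets the recursion apply at
    \<open>k = 0\<close> as well.\<close>
  define h where "h = pCons 0 g"
  have h: "real_rooted h" using Cons.prems(2) by (simp add: h_def real_rooted_pCons_0_iff)
  define E where "E i = coeff (even_part fs * h) (k + i)" for i
  define F where "F i = coeff (odd_part fs * h) (k + i)" for i
  have e': "coeff (even_part (ab # fs) * g) (k + i) = E (Suc i) + b * E i + a * F (Suc i)" for i
  proof -
    have "coeff (even_part (ab # fs) * g) (k + i) = coeff (even_part (ab # fs) * h) (Suc (k + i))"
      by (simp add: h_def)
    then show ?thesis by (simp add: E_def F_def ab coeff_even_part_Cons_mult del: even_part.simps)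
  qed
  have f': "coeff (odd_part (ab # fs) * g) (k + i) = F (Suc i) + b * F i + a * E i" for i
  proof -
    have "coeff (odd_part (ab # fs) * g) (k + i) = coeff (odd_part (ab # fs) * h) (Suc (k + i))"
      by (simp add: h_def)
    then show ?thesis by (simp add: E_def F_def ab coeff_odd_part_Cons_mult del: odd_part.simps)
  qed
  have pencil: "(F 1 + z * F 0) * (F 2 + z * F 1) \<le> (E 1 + z * E 0)\<^sup>2" for z
  proof -
    have "real_rooted ([:1, z:] * h)" by (intro real_rooted_mult real_rooted_linear h)
    from Cons.IH[OF fs this, of "Suc k"] show ?thesis
      by (simp only: Suc_eq_plus1[symmetric] coeff_mult_linear) (simp add: E_def F_def numeral_2_eq_2)
  qed
  have "E 0 * F 2 \<le> E 1 * F 1" "F 0 * E 1 \<le> F 1 * E 0"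
    using interlacing_minors[OF fs' h, of k] by (simp_all add: E_def F_def)
  from quadratic_factor_step[OF pencil this] a show ?case
    using e'[of 0] f'[of 0] f'[of 1] by (simp add: numeral_2_eq_2)
qed simp

subsection \<open>Elementary symmetric functions\<close>

definition factor_poly :: "(real \<times> real) list \<Rightarrow> real poly" where
  "factor_poly fs = (\<Prod>(a, b)\<leftarrow>fs. [:1, a, b:])"

lemma coeff_0_odd_part: "coeff (odd_part fs) 0 = 0"
  by (induction fs) auto

text \<open>This ties the recursion to the splitting \<open>E (t^2) + t O (t^2)\<close>; the odd
  index is one higher because \<open>odd_part\<close> is \<open>s O (s)\<close>.\<close>

lemma coeff_factor_poly:
  "coeff (factor_poly fs) (2 * k) = coeff (even_part fs) k \<and>
   coeff (factor_poly fs) (2 * k + 1) = coeff (odd_part fs) (k + 1)"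
proof (induction fs arbitrary: k)
  case Nil
  then show ?case by (auto simp: factor_poly_def)
next
  case (Cons ab fs)
  obtain a b where ab: "ab = (a, b)" by force
  have "factor_poly (ab # fs) = [:1, a, b:] * factor_poly fs" by (simp add: ab factor_poly_def)
  then have c: "coeff (factor_poly (ab # fs)) i = coeff (factor_poly fs) i
      + a * (if i = 0 then 0 else coeff (factor_poly fs) (i - 1))
      + b * (if i < 2 then 0 else coeff (factor_poly fs) (i - 2))" for i
    by (auto simp: coeff_pCons split: nat.split)
  show ?case
  proof (cases k)
    case 0
    then show ?thesis using Cons[of 0] unfolding c by (simp add: ab coeff_0_odd_part)
  next
    case (Suc k')
    then show ?thesis using Cons[of k'] Cons[of k] unfolding c by (simp add: ab)
  qed
qed

text \<open>Each term of the expanded product belongs to a set of indices, whose size is the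
  exponent. Beyond the length there is no such set, which matches the default value 0 in
  \<open>esym\<close>.\<close>

lemma esym_eq_coeff:
  assumes "0 \<le> j"
  shows "esym j xs = coeff (\<Prod>x\<leftarrow>xs. [:1, x:]) (nat j)"
proof -
  let ?n = "length xs"
  have "(\<Prod>x\<leftarrow>xs. [:1, x:]) = (\<Prod>i<?n. monom (xs ! i) 1 + 1)"
    by (simp add: prod.list_conv_set_nth atLeast0LessThan monom_altdef one_pCons)
  also have "\<dots> = (\<Sum>I\<in>Pow {..<?n}. monom (\<Prod>i\<in>I. xs ! i) (card I))"
  proof -
    have "(\<Prod>i\<in>I. monom (xs ! i) 1) = monom (\<Prod>i\<in>I. xs ! i) (card I)" if "finite I" for I
      using that by (induction I rule: finite_induct) (simp_all add: mult_monom)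
    then show ?thesis
      by (subst prod_add) (auto intro!: sum.cong simp: finite_subset)
  qed
  finally have "coeff (\<Prod>x\<leftarrow>xs. [:1, x:]) (nat j) =
      (\<Sum>I\<in>Pow {..<?n}. if card I = nat j then \<Prod>i\<in>I. xs ! i else 0)"
    by (simp add: coeff_sum)
  also have "\<dots> = (\<Sum>I | I \<subseteq> {..<?n} \<and> card I = nat j. \<Prod>i\<in>I. xs ! i)"
    by (simp add: sum.inter_filter[symmetric] Pow_def)
  finally have c: "coeff (\<Prod>x\<leftarrow>xs. [:1, x:]) (nat j) = \<dots>" .
  have empty: "{I. I \<subseteq> {..<?n} \<and> card I = nat j} = {}" if "int ?n < j"
  proof -
    have "card I \<noteq> nat j" if "I \<subseteq> {..<?n}" for I
      using card_mono[OF finite_lessThan that] \<open>int ?n < j\<close> by simp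
    then show ?thesis by blast
  qed
  show ?thesis
  proof (cases "int ?n < j")
    case True
    then show ?thesis using c unfolding empty[OF True] by (simp add: esym_def)
  next
    case False
    then show ?thesis using assms c by (simp add: esym_def)
  qed
qed

lemma degree_prod_linear:
  assumes "0 \<notin> set xs"
  shows "degree (\<Prod>x\<leftarrow>xs. [:1, x::complex:]) = length xs"
  using assms
proof (induction xs)
  case (Cons x xs)
  then have "x \<noteq> 0" "(\<Prod>x\<leftarrow>xs. [:1, x:]) \<noteq> 0" by (auto simp: prod_list_zero_iff)
  then show ?case using Cons by (simp add: degree_mult_eq del: mult_pCons_left)
qed simp

lemma coeffs_pos_mult:
  fixes p q :: "real poly"
  assumes p: "\<forall>i\<le>degree p. coeff p i > 0" and q: "\<forall>i\<le>degree q. coeff q i > 0"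
  shows "\<forall>i\<le>degree (p * q). coeff (p * q) i > 0"
proof (intro allI impI)
  fix i assume i: "i \<le> degree (p * q)"
  have "coeff p i \<ge> 0" "coeff q i \<ge> 0" for i
    using p q by (metis coeff_eq_0 less_eq_real_def not_le)+
  then have nn: "0 \<le> coeff p j * coeff q (i - j)" for j by simp
  \<comment> \<open>At this index both coefficients lie within the degrees, so one summand of the
    convolution is positive.\<close>
  let ?j = "min i (degree p)"
  have "i - ?j \<le> degree q" using i degree_mult_le[of p q] by auto
  then have "0 < coeff p ?j * coeff q (i - ?j)" using p q by simp
  also have "\<dots> \<le> (\<Sum>j\<le>i. coeff p j * coeff q (i - j))"
    using nn by (intro member_le_sum) auto
  finally show "coeff (p * q) i > 0" by (simp add: coeff_mult)
qed

lemma coeff_factor_poly_pos: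
  assumes "\<forall>(a, b)\<in>set fs. a > 0 \<and> b \<ge> 0"
  shows "\<forall>i\<le>degree (factor_poly fs). coeff (factor_poly fs) i > 0"
  using assms
proof (induction fs)
  case Nil
  then show ?case by (simp add: factor_poly_def)
next
  case (Cons ab fs)
  obtain a b where ab: "ab = (a, b)" by force
  then have "a > 0" "b \<ge> 0" using Cons.prems by auto
  then have "\<forall>i\<le>degree [:1, a, b:]. coeff [:1, a, b:] i > 0"
    by (auto simp: coeff_pCons split: nat.split if_splits)
  from coeffs_pos_mult[OF this Cons.IH] Cons.prems show ?case
    by (simp add: ab factor_poly_def)
qed

section \<open>Real factors from conjugate pairs\<close>

text \<open>Entries are removed by induction: \<open>z\<close> together with \<open>cnj z\<close>
  gives \<open>(2 * Re z, (cmod z)^2)\<close>, which satisfies \<open>a^2 \<le> 4 b\<close>, and a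
  single real \<open>z\<close> gives \<open>(Re z, 0)\<close>.\<close>

lemma quadratic_factorisation:
  assumes "\<forall>x\<in>#M. 0 < Re x" and "\<forall>z. count M z = count M (cnj z)"
  shows "\<exists>fs. (\<forall>(a, b)\<in>set fs. a > 0 \<and> b \<ge> 0) \<and> (\<Prod>x\<in>#M. [:1, x:]) = cpoly (factor_poly fs) \<and>
    ((\<forall>x\<in>\<real>. even (count M x)) \<longrightarrow> (\<forall>(a, b)\<in>set fs. a\<^sup>2 \<le> 4 * b))"
  using assms
proof (induction "size M" arbitrary: M rule: less_induct)
  case less
  let ?ev = "\<lambda>M :: complex multiset. \<forall>x\<in>\<real>. even (count M x)"
  show ?case
  proof (cases "M = {#}")
    case True
    then show ?thesis by (intro exI[of _ "[]"]) (simp add: factor_poly_def)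
  next
    case False
    then obtain z where z: "z \<in># M" by blast
    then have Rez: "0 < Re z" using less.prems by blast
    show ?thesis
    \<comment> \<open>A real entry is removed singly only if some real multiplicity is odd, when the
      last claim is vacuous. Otherwise it occurs at least twice and is removed as the pair
      \<open>z\<close>, \<open>cnj z\<close>.\<close>
    proof (cases "z \<in> \<real> \<and> \<not> ?ev M")
      case True
      define N where "N = M - {#z#}"
      have M: "M = add_mset z N" using z by (simp add: N_def)
      have zc: "cnj z = z" using True Reals_cnj_iff by blast
      have "count N w = count N (cnj w)" for w
        using less.prems(2) zc unfolding M by (metis add_left_cancel complex_cnj_cnj count_add_mset nat.inject)
      then obtain fs where fs: "\<forall>(a, b)\<in>set fs. a > 0 \<and> b \<ge> 0" "(\<Prod>x\<in>#N. [:1, x:]) = cpoly (factor_poly fs)"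
        using less.hyps[of N] less.prems(1) M by auto
      have "(\<Prod>x\<in>#M. [:1, x:]) = cpoly (factor_poly ((Re z, 0) # fs))"
        using True fs(2) by (simp add: M factor_poly_def of_real_Re)
      then show ?thesis using fs(1) True Rez by (intro exI[of _ "(Re z, 0) # fs"]) auto
    next
      case nreal: False
      define N where "N = M - {#z, cnj z#}"
      have "{#z, cnj z#} \<subseteq># M"
      proof (cases "z \<in> \<real>")
        case True
        then have "even (count M z)" using nreal by blast
        moreover have "count M z > 0" using z by simp
        ultimately have "count M z \<ge> 2" by presburger
        then show ?thesis using True by (auto simp: subseteq_mset_def Reals_cnj_iff)
      next
        case False
        then have "cnj z \<noteq> z" by (simp add: Reals_cnj_iff)
        moreover have "count M z > 0" "count M (cnj z) > 0" using z less.prems(2) by (metis count_greater_zero_iff)+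
        ultimately show ?thesis by (auto simp: subseteq_mset_def Suc_le_eq)
      qed
      then have M: "M = add_mset z (add_mset (cnj z) N)"
        by (simp add: N_def) (metis add_mset_add_single subset_mset.diff_add union_mset_add_mset_right)
      have cnt: "count M w = count N w + count {#z, cnj z#} w" for w by (simp add: M)
      have sym: "count {#z, cnj z#} w = count {#z, cnj z#} (cnj w)" for w by auto
      have "count N w = count N (cnj w)" for w
        using less.prems(2) cnt sym by (metis add_right_cancel)
      then obtain fs where fs: "\<forall>(a, b)\<in>set fs. a > 0 \<and> b \<ge> 0" "(\<Prod>x\<in>#N. [:1, x:]) = cpoly (factor_poly fs)"
          "?ev N \<longrightarrow> (\<forall>(a, b)\<in>set fs. a\<^sup>2 \<le> 4 * b)"
        using less.hyps[of N] less.prems(1) M by auto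
      have "?ev N" if "?ev M"
      proof
        fix x :: complex assume x: "x \<in> \<real>"
        then have "even (count {#z, cnj z#} x)" by (auto simp: Reals_cnj_iff)
        then show "even (count N x)" using that x cnt by (metis even_add)
      qed
      moreover have "(\<Prod>x\<in>#M. [:1, x:]) = cpoly (factor_poly ((2 * Re z, (cmod z)\<^sup>2) # fs))"
      proof -
        have "[:1, z:] * [:1, cnj z:] = cpoly [:1, 2 * Re z, (cmod z)\<^sup>2:]"
          using complex_norm_square[of z] by (simp add: complex_add_cnj add.commute mult.commute)
        moreover have "(\<Prod>x\<in>#M. [:1, x:]) = ([:1, z:] * [:1, cnj z:]) * (\<Prod>x\<in>#N. [:1, x:])"
          unfolding M by (simp add: mult.assoc del: mult_pCons_left mult_pCons_right)
        moreover have "factor_poly ((2 * Re z, (cmod z)\<^sup>2) # fs) = [:1, 2 * Re z, (cmod z)\<^sup>2:] * factor_poly fs"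
          by (simp add: factor_poly_def)
        ultimately show ?thesis using fs(2) by (simp only: cpoly_mult)
      qed
      moreover have "(2 * Re z)\<^sup>2 \<le> 4 * (cmod z)\<^sup>2" by (simp add: cmod_power2 power_mult_distrib)
      ultimately show ?thesis using fs Rez by (intro exI[of _ "(2 * Re z, (cmod z)\<^sup>2) # fs"]) auto
    qed
  qed
qed

section \<open>From neighbouring to arbitrary indices\<close>

text \<open>In cross-multiplied form, the ratio \<open>v i / u i\<close> is nonincreasing.\<close>

lemma ratio_chain:
  fixes u v :: "nat \<Rightarrow> real"
  assumes "k \<le> l" and "\<And>i. k \<le> i \<Longrightarrow> i \<le> l \<Longrightarrow> 0 < u i"
    and "\<And>i. k \<le> i \<Longrightarrow> i < l \<Longrightarrow> u i * v (Suc i) \<le> u (Suc i) * v i"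
  shows "u k * v l \<le> u l * v k"
  using assms
proof (induction l rule: dec_induct)
  case (step l)
  have IH: "u k * v l \<le> u l * v k" using step by simp
  have pos: "u k > 0" "u l > 0" "u (Suc l) > 0" using step by auto
  have "u l * (u k * v (Suc l)) = u k * (u l * v (Suc l))" by simp
  also have "\<dots> \<le> u k * (u (Suc l) * v l)" using step.prems(2)[of l] step.hyps pos by (intro mult_left_mono) auto
  also have "\<dots> = u (Suc l) * (u k * v l)" by simp
  also have "\<dots> \<le> u (Suc l) * (u l * v k)" using IH pos by (intro mult_left_mono) auto
  also have "\<dots> = u l * (u (Suc l) * v k)" by simp
  finally show ?case using pos by (simp add: mult_le_cancel_left_pos)
qed simp

lemma newton_chain:
  assumes p: "real_rooted p" and pos: "\<And>i. i \<le> degree p \<Longrightarrow> 0 < coeff p i"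
    and k: "1 \<le> k" "k \<le> l" "l < degree p"
  shows "(real l + 1) * (real (degree p) - real k + 1) / (real k * (real (degree p) - real l))
      * (coeff p (k - 1) * coeff p (l + 1)) \<le> coeff p k * coeff p l"
proof -
  \<comment> \<open>With these weights Newton's inequality says exactly that
    \<open>v i / u i\<close> is nonincreasing; the chain runs from \<open>k - 1\<close> to
    \<open>l\<close>.\<close>
  define u where "u i = (real (degree p) - real i) * coeff p i" for i
  define v where "v i = real (i + 1) * coeff p (i + 1)" for i
  have "u (k - 1) * v l \<le> u l * v (k - 1)"
  proof (rule ratio_chain)
    show "0 < u i" if "i \<le> l" for i using that k(3) by (simp add: u_def pos)
    show "u i * v (Suc i) \<le> u (Suc i) * v i" if "i < l" for i
    proof -
      have "i + 2 \<le> degree p" using that k(3) by simp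
      then obtain j where "degree p = i + 2 + j" using le_iff_add by blast
      then have j: "degree p = i + j + 2" by simp
      from newton_inequality[OF p this] show ?thesis
        by (simp add: newton_at_def u_def v_def j power2_eq_square algebra_simps)
    qed
  qed (use k in auto)
  then show ?thesis using k by (simp add: u_def v_def field_simps of_nat_diff)
qed

subsection \<open>The inequalities\<close>

text \<open>Here \<open>0 < a^2 \<le> 4 b\<close> forces \<open>b \<noteq> 0\<close>, so every
  factor has degree exactly two.\<close>

lemma even_degree_factor_poly:
  assumes "\<forall>(a, b)\<in>set fs. a > 0 \<and> a\<^sup>2 \<le> 4 * b"
  shows "even (degree (factor_poly fs))"
  using assms
proof (induction fs)
  case Nil
  then show ?case by (simp add: factor_poly_def)
next
  case (Cons ab fs)
  obtain a b where ab: "ab = (a, b)" by force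
  with Cons.prems have "0 < a\<^sup>2" "a\<^sup>2 \<le> 4 * b" by auto
  then have "b \<noteq> 0" by linarith
  have "factor_poly fs \<noteq> 0" by (auto simp: factor_poly_def prod_list_zero_iff)
  then have "degree ([:1, a, b:] * factor_poly fs) = 2 + degree (factor_poly fs)"
    using \<open>b \<noteq> 0\<close> by (subst degree_mult_eq) auto
  then show ?case using Cons by (simp add: ab factor_poly_def del: mult_pCons_left)
qed

text \<open>Translates the results on \<open>even_part\<close> and \<open>odd_part\<close>, taken
  with \<open>g = 1\<close>, into \<open>re_esym\<close>. \<open>D\<close> is
  \<open>odd_part\<close> without its factor \<open>s\<close>, so its indices are one lower.\<close>

lemma even_odd_esym:
  assumes "xs \<noteq> []" and sc: "self_conjugate xs" and re: "\<forall>x\<in>set xs. 0 < Re x"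
  obtains E D where
    "\<And>k. re_esym (2 * int k) xs = coeff E k" "\<And>k. re_esym (2 * int k + 1) xs = coeff D k"
    "\<And>j. 0 \<le> j \<Longrightarrow> j \<le> int (length xs) \<Longrightarrow> 0 < re_esym j xs"
    "real_rooted E" "real_rooted D"
    "\<And>k. coeff E k * coeff D (k + 1) \<le> coeff E (k + 1) * coeff D k"
    "\<And>k. coeff D k * coeff E (k + 2) \<le> coeff D (k + 1) * coeff E (k + 1)"
    "\<forall>x\<in>\<real>. even (count_list xs x) \<Longrightarrow> (\<And>k. coeff D k * coeff D (k + 1) \<le> (coeff E (k + 1))\<^sup>2)"
    "\<forall>x\<in>\<real>. even (count_list xs x) \<Longrightarrow> even (length xs)"
proof -
  have sym: "count (mset xs) z = count (mset xs) (cnj z)" for z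
    using sc unfolding self_conjugate_def count_mset by (metis Reals_cnj_iff)
  obtain fs where fs: "\<forall>(a, b)\<in>set fs. a > 0 \<and> b \<ge> 0"
    and prod: "(\<Prod>x\<in>#mset xs. [:1, x:]) = cpoly (factor_poly fs)"
    and ev: "(\<forall>x\<in>\<real>. even (count (mset xs) x)) \<longrightarrow> (\<forall>(a, b)\<in>set fs. a\<^sup>2 \<le> 4 * b)"
    using quadratic_factorisation[of "mset xs"] re sym by auto
  have prod': "(\<Prod>x\<leftarrow>xs. [:1, x:]) = cpoly (factor_poly fs)"
    using prod by (metis mset_map prod_mset_prod_list)
  have re_esym: "re_esym j xs = coeff (factor_poly fs) (nat j)" if "0 \<le> j" for j
    unfolding re_esym_def esym_eq_coeff[OF that] prod' by (simp add: coeff_map_poly)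
  have "0 \<notin> set xs" using re by force
  then have deg: "degree (factor_poly fs) = length xs"
    using degree_prod_linear[of xs] unfolding prod' by simp
  then have "fs \<noteq> []" using assms(1) by (auto simp: factor_poly_def)
  obtain D where D: "odd_part fs = pCons 0 D"
    using coeff_0_odd_part[of fs] by (metis coeff_pCons_0 pCons_cases)
  have disc: "\<forall>(a, b)\<in>set fs. a > 0 \<and> a\<^sup>2 \<le> 4 * b" if "\<forall>x\<in>\<real>. even (count_list xs x)"
    using that fs ev by (fastforce simp: count_mset)
  show thesis
  proof (rule that[of "even_part fs" D])
    fix k :: nat
    show "re_esym (2 * int k) xs = coeff (even_part fs) k"
      using coeff_factor_poly[of fs k] by (simp add: re_esym nat_mult_distrib)
    show "re_esym (2 * int k + 1) xs = coeff D k"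
      using coeff_factor_poly[of fs k] by (simp add: re_esym nat_add_distrib nat_mult_distrib D)
    show "coeff (even_part fs) k * coeff D (k + 1) \<le> coeff (even_part fs) (k + 1) * coeff D k"
      using interlacing_minors[OF fs real_rooted_1, of k] by (simp add: D)
    show "coeff D k * coeff (even_part fs) (k + 2) \<le> coeff D (k + 1) * coeff (even_part fs) (k + 1)"
      using interlacing_minors[OF fs real_rooted_1, of "k + 1"] by (simp add: D)
    assume "\<forall>x\<in>\<real>. even (count_list xs x)"
    note fs4 = disc[OF this]
    show "even (length xs)" unfolding deg[symmetric] using fs4 by (rule even_degree_factor_poly)
    from fs4 have "\<forall>(a, b)\<in>set fs. a > 0 \<and> a\<^sup>2 \<le> 4 * b" .
    from odd_part_le_even_part[OF this real_rooted_1, of "k + 1"]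
    show "coeff D k * coeff D (k + 1) \<le> (coeff (even_part fs) (k + 1))\<^sup>2" by (simp add: D)
  next
    fix j :: int assume "0 \<le> j" "j \<le> int (length xs)"
    then show "0 < re_esym j xs" using coeff_factor_poly_pos[OF fs] deg by (simp add: re_esym nat_le_iff)
  next
    show "real_rooted (even_part fs)" using fs by (rule real_rooted_even_part)
    show "real_rooted D"
      using real_rooted_odd_part[OF fs \<open>fs \<noteq> []\<close>] by (simp add: D real_rooted_pCons_0_iff)
  qed
qed

lemma re_esym_out_of_range: "j < 0 \<or> int (length xs) < j \<Longrightarrow> re_esym j xs = 0"
  by (simp add: re_esym_def esym_def)

lemma degree_eqI:
  assumes "coeff p d \<noteq> 0" and "\<And>i. d < i \<Longrightarrow> coeff p i = 0"
  shows "degree p = d"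
  using assms by (meson degree_le le_antisym le_degree)

text \<open>Treats (i) and (ii) at once: \<open>r = 0\<close> selects \<open>E\<close>,
  \<open>r = 1\<close> selects \<open>D\<close>, and \<open>m\<close> is the degree of the selected
  polynomial.\<close>

lemma strict_newton_esym:
  assumes "xs \<noteq> []" and "self_conjugate xs" and "\<forall>x\<in>set xs. 0 < Re x"
    and r: "r \<in> {0, 1}" and m: "m = (int (length xs) - r) div 2"
    and kl: "1 \<le> k" "k \<le> l" "l < m"
  shows "(real_of_int l + 1) * (real_of_int m - real_of_int k + 1) / (real_of_int k * (real_of_int m - real_of_int l))
    * (re_esym (2 * k - 2 + r) xs * re_esym (2 * l + 2 + r) xs) \<le> re_esym (2 * k + r) xs * re_esym (2 * l + r) xs"
proof -
  from even_odd_esym[OF assms(1-3)] obtain E D where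
    E: "\<And>k. re_esym (2 * int k) xs = coeff E k" and D: "\<And>k. re_esym (2 * int k + 1) xs = coeff D k"
    and pos: "\<And>j. 0 \<le> j \<Longrightarrow> j \<le> int (length xs) \<Longrightarrow> 0 < re_esym j xs"
    and rr: "real_rooted E" "real_rooted D" by metis
  obtain p where p: "real_rooted p" and c: "\<And>k. re_esym (2 * int k + r) xs = coeff p k"
    using r E D rr by (metis add_0_right empty_iff insert_iff)
  have cpos: "0 < coeff p i" if "int i \<le> m" for i
    using pos[of "2 * int i + r"] that r m by (auto simp: c[symmetric])
  have m0: "m \<ge> 0" using kl by simp
  have deg: "degree p = nat m"
  proof (rule degree_eqI)
    show "coeff p (nat m) \<noteq> 0" using cpos[of "nat m"] m0 by simp
    show "coeff p i = 0" if "nat m < i" for i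
      unfolding c[symmetric] by (rule re_esym_out_of_range) (use that r m in auto)
  qed
  have "(real (nat l) + 1) * (real (degree p) - real (nat k) + 1) / (real (nat k) * (real (degree p) - real (nat l)))
      * (coeff p (nat k - 1) * coeff p (nat l + 1)) \<le> coeff p (nat k) * coeff p (nat l)"
    by (rule newton_chain[OF p]) (use cpos deg kl m0 in auto)
  moreover have "coeff p (nat k) = re_esym (2 * k + r) xs" "coeff p (nat l) = re_esym (2 * l + r) xs"
    "coeff p (nat k - 1) = re_esym (2 * k - 2 + r) xs" "coeff p (nat l + 1) = re_esym (2 * l + 2 + r) xs"
    unfolding c[symmetric] using kl by (auto simp: of_nat_diff algebra_simps)
  ultimately show ?thesis using kl m0 deg by simp
qed

lemma re_esym_nonneg:
  assumes "self_conjugate xs" and "\<forall>x\<in>set xs. 0 < Re x"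
  shows "0 \<le> re_esym j xs"
proof (cases "j < 0 \<or> int (length xs) < j")
  case True
  then show ?thesis by (simp only: re_esym_out_of_range)
next
  case range: False
  show ?thesis
  proof (cases "xs = []")
    case True
    with range have "j = 0" by simp
    then show ?thesis by (simp add: re_esym_def esym_0)
  next
    case False
    with range show ?thesis using even_odd_esym[of xs] assms by (metis less_imp_le not_less)
  qed
qed

text \<open>The minors say that the ratio of \<open>re_esym\<close> at \<open>2 * i + 1\<close> and
  at \<open>2 * i\<close> is nonincreasing in \<open>i\<close>; compare \<open>k - 1\<close> with
  \<open>l\<close>.\<close>

lemma strict_odd_even:
  assumes "xs \<noteq> []" and "self_conjugate xs" and "\<forall>x\<in>set xs. 0 < Re x" and "k \<le> l"
  shows "re_esym (2 * k - 2) xs * re_esym (2 * l + 1) xs \<le> re_esym (2 * k - 1) xs * re_esym (2 * l) xs"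
\<comment> \<open>Outside this range the left product vanishes and the right one is
  nonnegative.\<close>
proof (cases "k < 1 \<or> int (length xs) < 2 * l + 1")
  case True
  then have "re_esym (2 * k - 2) xs = 0 \<or> re_esym (2 * l + 1) xs = 0"
    by (auto intro: re_esym_out_of_range)
  then show ?thesis using re_esym_nonneg[OF assms(2,3)] by (auto intro: mult_nonneg_nonneg)
next
  case False
  from even_odd_esym[OF assms(1-3)] obtain E D where
    E: "\<And>k. re_esym (2 * int k) xs = coeff E k" and D: "\<And>k. re_esym (2 * int k + 1) xs = coeff D k"
    and pos: "\<And>j. 0 \<le> j \<Longrightarrow> j \<le> int (length xs) \<Longrightarrow> 0 < re_esym j xs"
    and minor: "\<And>k. coeff E k * coeff D (k + 1) \<le> coeff E (k + 1) * coeff D k" by metis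
  have l0: "0 \<le> l" and k1: "int (nat k - Suc 0) = k - 1" using False assms(4) by auto
  have "coeff E (nat k - 1) * coeff D (nat l) \<le> coeff E (nat l) * coeff D (nat k - 1)"
  proof (rule ratio_chain)
    show "0 < coeff E i" if "i \<le> nat l" for i
      using pos[of "2 * int i"] that[unfolded le_nat_iff[OF l0]] False assms(4) by (simp add: E[symmetric])
  qed (use minor False assms(4) in auto)
  then show ?thesis using False assms(4) unfolding E[symmetric] D[symmetric]
    by (simp add: k1 algebra_simps)
qed

text \<open>The same comparison for the ratio at \<open>2 * i + 2\<close> and
  \<open>2 * i + 1\<close>.\<close>

lemma strict_even_odd:
  assumes "xs \<noteq> []" and "self_conjugate xs" and "\<forall>x\<in>set xs. 0 < Re x" and "k \<le> l"
  shows "re_esym (2 * k - 1) xs * re_esym (2 * l + 2) xs \<le> re_esym (2 * k) xs * re_esym (2 * l + 1) xs"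
proof (cases "k < 1 \<or> int (length xs) < 2 * l + 2")
  case True
  then have "re_esym (2 * k - 1) xs = 0 \<or> re_esym (2 * l + 2) xs = 0"
    by (auto intro: re_esym_out_of_range)
  then show ?thesis using re_esym_nonneg[OF assms(2,3)] by (auto intro: mult_nonneg_nonneg)
next
  case False
  from even_odd_esym[OF assms(1-3)] obtain E D where
    E: "\<And>k. re_esym (2 * int k) xs = coeff E k" and D: "\<And>k. re_esym (2 * int k + 1) xs = coeff D k"
    and pos: "\<And>j. 0 \<le> j \<Longrightarrow> j \<le> int (length xs) \<Longrightarrow> 0 < re_esym j xs"
    and minor: "\<And>k. coeff D k * coeff E (k + 2) \<le> coeff D (k + 1) * coeff E (k + 1)" by metis
  have l0: "0 \<le> l" and k1: "int (nat k - Suc 0) = k - 1" using False assms(4) by auto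
  have "coeff D (nat k - 1) * coeff E (Suc (nat l)) \<le> coeff D (nat l) * coeff E (Suc (nat k - 1))"
  proof (rule ratio_chain)
    show "0 < coeff D i" if "i \<le> nat l" for i
      using pos[of "2 * int i + 1"] that[unfolded le_nat_iff[OF l0]] False assms(4) by (simp add: D[symmetric])
  qed (use minor False assms(4) in auto)
  then show ?thesis using False assms(4) unfolding E[symmetric] D[symmetric]
    by (simp add: k1 algebra_simps)
qed

text \<open>The diagonal inequalities at \<open>k\<close> and \<open>l\<close> multiply to a bound
  on four odd-index factors. Trading those at \<open>2 * k + 1\<close> and \<open>2 * l - 1\<close>
  for those at \<open>2 * k - 1\<close> and \<open>2 * l + 1\<close> costs the factor
  \<open>?R\<close> and leaves the square of the claim.\<close>

lemma strict_even_even: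
  assumes "xs \<noteq> []" and "self_conjugate xs" and "\<forall>x\<in>set xs. 0 < Re x"
    and ev: "\<forall>x\<in>\<real>. even (count_list xs x)"
    and n: "int (length xs) = 2 * m" and kl: "1 \<le> k" "k \<le> l" "l < m"
  shows "sqrt (real_of_int (l * (m - k)) / real_of_int (k * (m - l))) * (re_esym (2 * k - 1) xs * re_esym (2 * l + 1) xs)
    \<le> re_esym (2 * k) xs * re_esym (2 * l) xs"
proof -
  let ?R = "real_of_int (l * (m - k)) / real_of_int (k * (m - l))"
  let ?e = "\<lambda>j. re_esym j xs"
  from even_odd_esym[OF assms(1-3)] ev obtain E D where
    E: "\<And>k. re_esym (2 * int k) xs = coeff E k" and D: "\<And>k. re_esym (2 * int k + 1) xs = coeff D k"
    and DE: "\<And>k. coeff D k * coeff D (k + 1) \<le> (coeff E (k + 1))\<^sup>2" by metis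
  have nonneg: "0 \<le> ?e j" for j using assms(2,3) by (rule re_esym_nonneg)
  have diag: "?e (2 * i - 1) * ?e (2 * i + 1) \<le> (?e (2 * i))\<^sup>2" if "1 \<le> i" for i
    using DE[of "nat i - 1"] that unfolding E[symmetric] D[symmetric] by (simp add: of_nat_diff algebra_simps)
  \<comment> \<open>For length \<open>2 * m\<close> the odd part has degree \<open>m - 1\<close>,
    and \<open>l - 1\<close> takes the place of \<open>l\<close>. When \<open>k = l\<close> this
    index is too small, but then \<open>?R\<close> is 1.\<close>
  have odd: "?R * (?e (2 * k - 1) * ?e (2 * l + 1)) \<le> ?e (2 * k + 1) * ?e (2 * l - 1)"
  proof (cases "k = l")
    case True
    then show ?thesis using kl by simp
  next
    case False
    have "m - 1 = (int (length xs) - 1) div 2" using n by simp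
    from strict_newton_esym[OF assms(1-3) _ this, of k "l - 1"] False kl
    show ?thesis by simp
  qed
  have "(sqrt ?R * (?e (2 * k - 1) * ?e (2 * l + 1)))\<^sup>2 = (?R * (?e (2 * k - 1) * ?e (2 * l + 1))) * (?e (2 * k - 1) * ?e (2 * l + 1))"
  proof -
    have "(sqrt ?R)\<^sup>2 = ?R" using kl by (intro real_sqrt_pow2) simp
    then show ?thesis unfolding power_mult_distrib by (simp only: power2_eq_square mult_ac)
  qed
  also have "\<dots> \<le> (?e (2 * k + 1) * ?e (2 * l - 1)) * (?e (2 * k - 1) * ?e (2 * l + 1))"
    using odd nonneg by (intro mult_right_mono) auto
  also have "\<dots> = (?e (2 * k - 1) * ?e (2 * k + 1)) * (?e (2 * l - 1) * ?e (2 * l + 1))" by simp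
  also have "\<dots> \<le> (?e (2 * k))\<^sup>2 * (?e (2 * l))\<^sup>2"
    using diag[of k] diag[of l] kl nonneg by (intro mult_mono) auto
  finally have "(sqrt ?R * (?e (2 * k - 1) * ?e (2 * l + 1)))\<^sup>2 \<le> (?e (2 * k) * ?e (2 * l))\<^sup>2"
    by (simp only: power_mult_distrib)
  then show ?thesis by (rule power2_le_imp_le) (use nonneg in simp)
qed

section \<open>Reduction to positive real parts\<close>

text \<open>A real shift commutes with conjugation, so it keeps the list self-conjugate and moves
  real multiplicities without changing them.\<close>

abbreviation shift_list :: "complex list \<Rightarrow> real \<Rightarrow> complex list" where
  "shift_list xs \<epsilon> \<equiv> map (\<lambda>x. x + of_real \<epsilon>) xs"

lemma count_list_shift: "count_list (shift_list xs \<epsilon>) z = count_list xs (z - of_real \<epsilon>)"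
  by (induction xs) (auto simp: algebra_simps)

lemma self_conjugate_shift: "self_conjugate xs \<Longrightarrow> self_conjugate (shift_list xs \<epsilon>)"
  unfolding self_conjugate_def count_list_shift
  by (metis Reals_add Reals_of_real complex_cnj_complex_of_real complex_cnj_diff diff_add_cancel)

lemma tendsto_re_esym_shift: "((\<lambda>\<epsilon>. re_esym j (shift_list xs \<epsilon>)) \<longlongrightarrow> re_esym j xs) (at_right 0)"
proof -
  have "((\<lambda>\<epsilon>. \<Sum>I | I \<subseteq> {..<length xs} \<and> card I = nat j. \<Prod>i\<in>I. xs ! i + of_real \<epsilon>) \<longlongrightarrow>
      (\<Sum>I | I \<subseteq> {..<length xs} \<and> card I = nat j. \<Prod>i\<in>I. xs ! i + of_real 0)) (at_right 0)"
    by (intro tendsto_intros)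
  moreover have "(\<Sum>I | I \<subseteq> {..<length xs} \<and> card I = nat j. \<Prod>i\<in>I. shift_list xs \<epsilon> ! i) =
      (\<Sum>I | I \<subseteq> {..<length xs} \<and> card I = nat j. \<Prod>i\<in>I. xs ! i + of_real \<epsilon>)" for \<epsilon>
    by (intro sum.cong prod.cong) auto
  ultimately have "((\<lambda>\<epsilon>. esym j (shift_list xs \<epsilon>)) \<longlongrightarrow> esym j xs) (at_right 0)"
    by (auto simp: esym_def)
  then show ?thesis unfolding re_esym_def by (rule tendsto_Re)
qed

text \<open>Both sides are polynomials in \<open>\<epsilon>\<close>, so the inequality survives as
  \<open>\<epsilon>\<close> tends to 0 from the right.\<close>

lemma esym_inequality_limit:
  assumes "\<And>\<epsilon>. 0 < \<epsilon> \<Longrightarrow> c * (re_esym i (shift_list xs \<epsilon>) * re_esym j (shift_list xs \<epsilon>))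
    \<le> re_esym p (shift_list xs \<epsilon>) * re_esym q (shift_list xs \<epsilon>)"
  shows "c * (re_esym i xs * re_esym j xs) \<le> re_esym p xs * re_esym q xs"
proof (rule tendsto_le)
  show "((\<lambda>\<epsilon>. c * (re_esym i (shift_list xs \<epsilon>) * re_esym j (shift_list xs \<epsilon>))) \<longlongrightarrow> c * (re_esym i xs * re_esym j xs)) (at_right 0)"
    "((\<lambda>\<epsilon>. re_esym p (shift_list xs \<epsilon>) * re_esym q (shift_list xs \<epsilon>)) \<longlongrightarrow> re_esym p xs * re_esym q xs) (at_right 0)"
    by (intro tendsto_intros tendsto_re_esym_shift)+
  show "\<forall>\<^sub>F \<epsilon> in at_right 0. c * (re_esym i (shift_list xs \<epsilon>) * re_esym j (shift_list xs \<epsilon>))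
      \<le> re_esym p (shift_list xs \<epsilon>) * re_esym q (shift_list xs \<epsilon>)"
    using eventually_at_right_less[of "0::real"] by eventually_elim (rule assms)
qed simp

theorem theorem1p4:
  fixes xs :: "complex list" and n :: nat
  assumes "n = length xs" and "n \<ge> 1"
    and "self_conjugate xs"
    and "\<forall>x\<in>set xs. 0 \<le> Re x"
  shows
    "(\<forall>k l. 1 \<le> k \<and> k \<le> l \<and> l \<le> \<lfloor>real n / 2\<rfloor> - 1 \<longrightarrow>
       re_esym (2*k) xs * re_esym (2*l) xs \<ge>
         real_of_int ((l + 1) * (\<lfloor>real n / 2\<rfloor> - k + 1)) / real_of_int (k * (\<lfloor>real n / 2\<rfloor> - l))
           * (re_esym (2*k - 2) xs * re_esym (2*l + 2) xs)) \<and>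
     (\<forall>k l. 1 \<le> k \<and> k \<le> l \<and> l \<le> \<lceil>real n / 2\<rceil> - 2 \<longrightarrow>
       re_esym (2*k + 1) xs * re_esym (2*l + 1) xs \<ge>
         real_of_int ((l + 1) * (\<lceil>real n / 2\<rceil> - k)) / real_of_int (k * (\<lceil>real n / 2\<rceil> - l - 1))
           * (re_esym (2*k - 1) xs * re_esym (2*l + 3) xs)) \<and>
     (\<forall>k l. k \<le> l \<longrightarrow> re_esym (2*k - 1) xs * re_esym (2*l) xs \<ge> re_esym (2*k - 2) xs * re_esym (2*l + 1) xs) \<and>
     (\<forall>k l. k \<le> l \<longrightarrow> re_esym (2*k) xs * re_esym (2*l + 1) xs \<ge> re_esym (2*k - 1) xs * re_esym (2*l + 2) xs) \<and>
     ((\<forall>x\<in>\<real>. even (count_list xs x)) \<longrightarrow>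
       (\<forall>k l. 1 \<le> k \<and> k \<le> l \<and> real_of_int l \<le> real n / 2 - 1 \<longrightarrow>
          re_esym (2*k) xs * re_esym (2*l) xs \<ge>
            sqrt (real_of_int (l * (int n - 2*k)) / real_of_int (k * (int n - 2*l)))
              * (re_esym (2*k - 1) xs * re_esym (2*l + 1) xs)))"
proof -
  have shift: "shift_list xs \<epsilon> \<noteq> []" "self_conjugate (shift_list xs \<epsilon>)" "\<forall>x\<in>set (shift_list xs \<epsilon>). 0 < Re x"
    if "0 < \<epsilon>" for \<epsilon>
    using assms that by (auto simp: self_conjugate_shift add_nonneg_pos)
  \<comment> \<open>These two values are the \<open>m\<close> of \<open>strict_newton_esym\<close>
    for \<open>r = 0\<close> and \<open>r = 1\<close>.\<close>
  have floor: "\<lfloor>real n / 2\<rfloor> = (int n - 0) div 2"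
    using floor_divide_of_int_eq[of "int n" 2, where ?'a = real] by simp
  have ceil: "\<lceil>real n / 2\<rceil> - 1 = (int n - 1) div 2"
    using ceiling_divide_eq_div[of "int n" 2, where ?'a = real] by simp
  show ?thesis
  proof (intro conjI allI impI)
    fix k l :: int assume kl: "1 \<le> k \<and> k \<le> l \<and> l \<le> \<lfloor>real n / 2\<rfloor> - 1"
    show "real_of_int ((l + 1) * (\<lfloor>real n / 2\<rfloor> - k + 1)) / real_of_int (k * (\<lfloor>real n / 2\<rfloor> - l))
           * (re_esym (2*k - 2) xs * re_esym (2*l + 2) xs) \<le> re_esym (2*k) xs * re_esym (2*l) xs"
    proof (rule esym_inequality_limit)
      fix \<epsilon> :: real assume \<epsilon>: "0 < \<epsilon>"
      have m: "\<lfloor>real n / 2\<rfloor> = (int (length (shift_list xs \<epsilon>)) - 0) div 2"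
        using floor assms(1) by simp
      from strict_newton_esym[OF shift[OF \<epsilon>] _ m, of k l] kl
      show "real_of_int ((l + 1) * (\<lfloor>real n / 2\<rfloor> - k + 1)) / real_of_int (k * (\<lfloor>real n / 2\<rfloor> - l))
           * (re_esym (2*k - 2) (shift_list xs \<epsilon>) * re_esym (2*l + 2) (shift_list xs \<epsilon>))
         \<le> re_esym (2*k) (shift_list xs \<epsilon>) * re_esym (2*l) (shift_list xs \<epsilon>)"
        by simp
    qed
  next
    fix k l :: int assume kl: "1 \<le> k \<and> k \<le> l \<and> l \<le> \<lceil>real n / 2\<rceil> - 2"
    show "real_of_int ((l + 1) * (\<lceil>real n / 2\<rceil> - k)) / real_of_int (k * (\<lceil>real n / 2\<rceil> - l - 1))
           * (re_esym (2*k - 1) xs * re_esym (2*l + 3) xs) \<le> re_esym (2*k + 1) xs * re_esym (2*l + 1) xs"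
    proof (rule esym_inequality_limit)
      fix \<epsilon> :: real assume \<epsilon>: "0 < \<epsilon>"
      have m: "\<lceil>real n / 2\<rceil> - 1 = (int (length (shift_list xs \<epsilon>)) - 1) div 2"
        using ceil assms(1) by simp
      from strict_newton_esym[OF shift[OF \<epsilon>] _ m, of k l] kl
      show "real_of_int ((l + 1) * (\<lceil>real n / 2\<rceil> - k)) / real_of_int (k * (\<lceil>real n / 2\<rceil> - l - 1))
           * (re_esym (2*k - 1) (shift_list xs \<epsilon>) * re_esym (2*l + 3) (shift_list xs \<epsilon>))
         \<le> re_esym (2*k + 1) (shift_list xs \<epsilon>) * re_esym (2*l + 1) (shift_list xs \<epsilon>)"
        by (simp add: diff_diff_eq add.commute)
    qed
  next
    fix k l :: int assume "k \<le> l"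
    then show "re_esym (2*k - 2) xs * re_esym (2*l + 1) xs \<le> re_esym (2*k - 1) xs * re_esym (2*l) xs"
      using esym_inequality_limit[of 1] strict_odd_even[OF shift] by simp
  next
    fix k l :: int assume "k \<le> l"
    then show "re_esym (2*k - 1) xs * re_esym (2*l + 2) xs \<le> re_esym (2*k) xs * re_esym (2*l + 1) xs"
      using esym_inequality_limit[of 1] strict_even_odd[OF shift] by simp
  next
    fix k l :: int
    assume ev: "\<forall>x\<in>\<real>. even (count_list xs x)" and kl: "1 \<le> k \<and> k \<le> l \<and> real_of_int l \<le> real n / 2 - 1"
    have ev': "\<forall>x\<in>\<real>. even (count_list (shift_list xs \<epsilon>) x)" for \<epsilon>
      using ev by (simp add: count_list_shift)
    \<comment> \<open>\<open>even_odd_esym\<close> asks for positive real parts, so parity is read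
      off a shifted list of the same length; any positive shift would do.\<close>
    have "even (length (shift_list xs 1))"
    proof (rule even_odd_esym[OF shift[OF zero_less_one]])
      assume "\<forall>x\<in>\<real>. even (count_list (shift_list xs 1) x) \<Longrightarrow> even (length (shift_list xs 1))"
      then show "even (length (shift_list xs 1))" using ev' by blast
    qed
    then have "even (int n)" using assms(1) by simp
    then obtain m where m: "int n = 2 * m" by (rule evenE)
    then have "real n = 2 * real_of_int m" by (metis of_int_mult of_int_numeral of_int_of_nat_eq)
    with kl have "l < m" by simp
    have "real_of_int (l * (2 * m - 2 * k)) / real_of_int (k * (2 * m - 2 * l)) =
        (2 * real_of_int (l * (m - k))) / (2 * real_of_int (k * (m - l)))"
      by (simp add: algebra_simps)
    then have R: "real_of_int (l * (int n - 2 * k)) / real_of_int (k * (int n - 2 * l)) =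
        real_of_int (l * (m - k)) / real_of_int (k * (m - l))"
      unfolding m by (simp only: mult_divide_mult_cancel_left[of 2] zero_neq_numeral)
    show "sqrt (real_of_int (l * (int n - 2*k)) / real_of_int (k * (int n - 2*l)))
              * (re_esym (2*k - 1) xs * re_esym (2*l + 1) xs) \<le> re_esym (2*k) xs * re_esym (2*l) xs"
      unfolding R
    proof (rule esym_inequality_limit, rule strict_even_even[OF shift ev'])
      show "int (length (shift_list xs \<epsilon>)) = 2 * m" for \<epsilon> using m assms(1) by simp
    qed (use kl \<open>l < m\<close> in auto)
  qed
qed

end
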